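(* Let $n\ge3$ be an integer. For $a,b\in\mathbb{R}\setminus\{0\}$ let $\mathcal{B}^n_{a,b}(\lambda)$ be the polynomial in $\lambda$ defined in the context. There exist finitely many real numbers $r'_1,\dots,r'_q\in\mathbb{R}$ such that for all $(a,b)$ with $a/b\notin\{r'_1,\dots,r'_q\}$, neither $a$ nor $b$ is a root of $\mathcal{B}^n_{a,b}$.
   Context: For $a,b\in\mathbb{R}\setminus\{0\}$ and $\lambda\in\mathbb{C}$, define $B_k(\lambda)$ ($k\ge0$) as the coefficients of the Taylor expansion at $t=0$ $$\sqrt{\Big(\tfrac{a-\lambda}{a}t+1\Big)\Big(\tfrac{b-\lambda}{b}t+1\Big)(t+1)}=\sum_{k\ge0}B_k(\lambda)t^k,$$ with the branch equal to $1$ at $t=0$; each $B_k$ is a polynomial in $\lambda$. The polynomial $\mathcal{B}^n_{a,b}$ is the determinant $$\mathcal{B}^n_{a,b}(\lambda)=\det\big(B_{i+j}(\lambda)\big)_{1\le i,j\le m}\quad\text{if }n=2m+1,\qquad \mathcal{B}^n_{a,b}(\lambda)=\det\big(B_{i+j+1}(\lambda)\big)_{1\le i,j\le m-1}\quad\text{if }n=2m.$$ *)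

theory Defs
  imports "HOL-Complex_Analysis.Complex_Analysis" "Jordan_Normal_Form.Determinant"
begin

text \<open>
  The complex variable \<open>z\<close> below is the parameter \<open>\<lambda>\<close> of the polynomials.
  Near \<open>t = 0\<close> the radicand is close to \<open>1\<close>, so the principal square root
  \<open>csqrt\<close> is holomorphic there and is the branch with value \<open>1\<close> at \<open>t = 0\<close>.
\<close>

definition B_coeff :: "real \<Rightarrow> real \<Rightarrow> nat \<Rightarrow> complex \<Rightarrow> complex" where
  "B_coeff a b k z =
     fps_nth (fps_expansion
       (\<lambda>t. csqrt (((of_real a - z) / of_real a * t + 1) *
                   ((of_real b - z) / of_real b * t + 1) * (t + 1))) 0) k"

text \<open>
  Matrices of Jordan_Normal_Form are indexed from \<open>0\<close>, whence \<open>Suc i\<close> and \<open>Suc j\<close>.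
  The determinant is that of Jordan_Normal_Form, not the one of HOL-Analysis.
\<close>

definition B_poly :: "nat \<Rightarrow> real \<Rightarrow> real \<Rightarrow> complex \<Rightarrow> complex" where
  "B_poly n a b z =
     (let m = n div 2 in
      if odd n
      then Determinant.det (mat m m (\<lambda>(i, j). B_coeff a b (Suc i + Suc j) z))
      else Determinant.det (mat (m - 1) (m - 1) (\<lambda>(i, j). B_coeff a b (Suc i + Suc j + 1) z)))"

lemma csqrt_fps_expansion:
  fixes g :: "complex \<Rightarrow> complex"
  assumes g: "g has_fps_expansion G" and G0: "fps_nth G 0 = 1"
  defines "F \<equiv> fps_expansion (\<lambda>t. csqrt (g t)) 0"
  shows "F * F = G" and "fps_nth F 0 = 1"
proof -
  have g0: "g 0 = 1"
    using has_fps_expansion_imp_0_eq_fps_nth_0[OF g] G0 by simp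
  have "g analytic_on {0}"
    using g by (rule has_fps_expansion_imp_analytic_0)
  hence "(\<lambda>t. csqrt (g t)) analytic_on {0}"
    by (intro analytic_on_csqrt') (auto simp: g0 complex_nonpos_Reals_iff)
  hence F: "(\<lambda>t. csqrt (g t)) has_fps_expansion F"
    unfolding F_def using analytic_at_imp_has_fps_expansion_0 by blast
  have "(\<lambda>t. csqrt (g t) * csqrt (g t)) has_fps_expansion F * F"
    by (intro has_fps_expansion_mult F)
  hence "g has_fps_expansion F * F"
    by (simp flip: power2_eq_square)
  thus "F * F = G"
    using g by (metis fps_expansion_unique_complex)
  show "fps_nth F 0 = 1"
    using has_fps_expansion_imp_0_eq_fps_nth_0[OF F] g0 by simp
qed

lemma B_coeff_sqrt:
  fixes a b :: real and z :: complex
  defines "F \<equiv> Abs_fps (\<lambda>k. B_coeff a b k z)"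
  shows "F * F = fps_of_poly ([:1, (of_real a - z) / of_real a:] *
                              [:1, (of_real b - z) / of_real b:] * [:1, 1:])"
    and "B_coeff a b 0 z = 1"
proof -
  let ?p = "[:1, (of_real a - z) / of_real a:] * [:1, (of_real b - z) / of_real b:] * [:1, 1:]"
  let ?g = "\<lambda>t. ((of_real a - z) / of_real a * t + 1) * ((of_real b - z) / of_real b * t + 1) * (t + 1)"
  have eq: "poly ?p = ?g"
    by (auto simp: fun_eq_iff algebra_simps simp del: mult_pCons_left mult_pCons_right)
  have "poly ?p has_fps_expansion fps_of_poly ?p"
    by (simp add: has_fps_expansion_def)
  hence g: "?g has_fps_expansion fps_of_poly ?p" unfolding eq .
  have G0: "fps_nth (fps_of_poly ?p) 0 = 1" by simp
  have F: "F = fps_expansion (\<lambda>t. csqrt (?g t)) 0"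
    by (simp add: F_def B_coeff_def fps_eq_iff)
  show "F * F = fps_of_poly ?p" "B_coeff a b 0 z = 1"
    using csqrt_fps_expansion[OF g G0] by (simp_all add: F B_coeff_def)
qed

text \<open>
  \<open>B_coeff\<close> and \<open>B_poly\<close> are defined as functions of \<open>z\<close>; the lemmas below show
  that they are polynomial functions.
\<close>

lemma B_coeff_polynomial: "\<exists>p :: complex poly. \<forall>z. B_coeff a b k z = poly p z"
proof (induction k rule: less_induct)
  case (less k)
  show ?case
  proof (cases "k = 0")
    case True
    thus ?thesis by (intro exI[of _ 1]) (simp add: B_coeff_sqrt)
  next
    case False
    from less have "\<forall>i. \<exists>p. i < k \<longrightarrow> (\<forall>z. B_coeff a b i z = poly p z)" by blast
    then obtain p where p: "\<And>i z. i < k \<Longrightarrow> B_coeff a b i z = poly (p i) z" by metis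
    define A :: "complex poly" where "A = [:1, - 1 / of_real a:]"
    define B :: "complex poly" where "B = [:1, - 1 / of_real b:]"
    define A' :: "complex poly" where "A' = (if a = 0 then 0 else A)"
    define B' :: "complex poly" where "B' = (if b = 0 then 0 else B)"
    define Q :: "complex poly poly" where "Q = [:1, A':] * [:1, B':] * [:1, 1:]"
    have A': "poly A' z = (of_real a - z) / of_real a" for z
      by (simp add: A'_def A_def field_simps)
    have B': "poly B' z = (of_real b - z) / of_real b" for z
      by (simp add: B'_def B_def field_simps)
    have Q: "map_poly (\<lambda>q. poly q z) Q = [:1, poly A' z:] * [:1, poly B' z:] * [:1, 1:]" for z
      by (simp add: Q_def map_poly_pCons)
    have "B_coeff a b k z = poly (Polynomial.smult (1/2) (coeff Q k - (\<Sum>i\<in>{1..<k}. p i * p (k - i)))) z" for z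
    proof -
      have "(\<Sum>i=0..k. B_coeff a b i z * B_coeff a b (k - i) z) =
            coeff ([:1, poly A' z:] * [:1, poly B' z:] * [:1, 1:]) k"
        using arg_cong[OF B_coeff_sqrt(1)[of a b z], of "\<lambda>F. fps_nth F k"]
        by (simp only: A' B' fps_mult_nth fps_nth_Abs_fps fps_of_poly_nth)
      also have "\<dots> = poly (coeff Q k) z"
        unfolding Q[symmetric] by (simp add: coeff_map_poly)
      also have "{0..k} = insert 0 (insert k {1..<k})" using False by auto
      also have "(\<Sum>i\<in>\<dots>. B_coeff a b i z * B_coeff a b (k - i) z) =
          2 * B_coeff a b k z + (\<Sum>i\<in>{1..<k}. B_coeff a b i z * B_coeff a b (k - i) z)"
        using False by (simp add: B_coeff_sqrt(2))
      also have "(\<Sum>i\<in>{1..<k}. B_coeff a b i z * B_coeff a b (k - i) z) =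
          (\<Sum>i\<in>{1..<k}. poly (p i) z * poly (p (k - i)) z)"
        by (intro sum.cong refl) (simp add: p)
      finally show ?thesis by (simp add: poly_sum field_simps)
    qed
    thus ?thesis by blast
  qed
qed

lemma det_polynomial:
  assumes "\<And>i j. \<exists>p :: complex poly. \<forall>z. f i j z = poly p z"
  shows "\<exists>p. \<forall>z. Determinant.det (mat d d (\<lambda>(i, j). f i j z)) = poly p z"
proof -
  from assms obtain p where p: "\<And>i j z. f i j z = poly (p i j) z" by metis
  have "Determinant.det (mat d d (\<lambda>(i, j). f i j z)) =
        poly (\<Sum>\<pi>\<in>{\<pi>. \<pi> permutes {0..<d}}. [:signof \<pi>:] * (\<Prod>i=0..<d. p i (\<pi> i))) z" for z
    unfolding Determinant.det_def
    by (auto simp: poly_sum poly_prod p intro!: sum.cong prod.cong simp: permutes_in_image)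
  thus ?thesis by blast
qed

lemma B_poly_polynomial: "\<exists>p :: complex poly. \<forall>z. B_poly n a b z = poly p z"
  unfolding B_poly_def Let_def
  by (cases "odd n") (simp_all only: if_True if_False not_True_eq_False not_False_eq_True,
      (intro det_polynomial B_coeff_polynomial)+)

end

theory Submission
  imports Defs
begin

text \<open>
  At \<open>\<lambda> = a\<close> the first factor of the radicand disappears, and what is left,
  \<open>((1 - a/b) t + 1) (t + 1)\<close>, depends on the ratio \<open>x = a/b\<close> alone. So the value at \<open>a\<close> is
  a polynomial function of \<open>x\<close>; by the symmetry of the radicand the value at \<open>b\<close> is the same
  function of \<open>1/x\<close>. Such a function has only finitely many zeros unless it vanishes
  identically, so it suffices to find one ratio at which it is nonzero.

  At \<open>x = 1\<close> the radicand is \<open>t + 1\<close> and the coefficients are the binomial coefficients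
  \<open>1/2 gchoose k\<close>. Their Hankel determinants are nonzero for a reason that is pure
  interpolation (\<open>det_hankel_gbinomial_half_nonzero\<close>): the quotient of
  \<open>1/2 gchoose (k + j)\<close> by \<open>1/2 gchoose k\<close> is a rational function of \<open>k\<close>, and after
  clearing a common denominator a kernel vector of length \<open>d\<close> becomes a polynomial of degree
  less than \<open>d\<close> that vanishes at \<open>d\<close> consecutive integers. It is therefore zero, and its values
  at \<open>1/2, -1/2, -3/2, \<dots>\<close> then recover the entries of the vector one at a time, all zero.
\<close>

section \<open>Hankel determinants of half-integer binomial coefficients\<close>

lemma gbinomial_add_right:
  fixes a :: "'a :: field_char_0"
  shows "(a gchoose (k + j)) * (\<Prod>l<j. of_nat k + of_nat l + 1) =
         (a gchoose k) * (\<Prod>l<j. a - of_nat k - of_nat l)"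
proof (induction j)
  case (Suc j)
  have "(a gchoose (k + Suc j)) * (of_nat k + of_nat j + 1) =
        (a gchoose (k + j)) * (a - of_nat k - of_nat j)"
    using gbinomial_mult_1[of a "k + j"] by (simp add: algebra_simps)
  hence "(a gchoose (k + Suc j)) * (\<Prod>l<Suc j. of_nat k + of_nat l + 1) =
        (a gchoose (k + j)) * (\<Prod>l<j. of_nat k + of_nat l + 1) * (a - of_nat k - of_nat j)"
    by (simp only: prod.lessThan_Suc mult_ac) (simp only: flip: mult.assoc)
  also have "\<dots> = (a gchoose k) * (\<Prod>l<Suc j. a - of_nat k - of_nat l)"
    by (simp only: Suc.IH prod.lessThan_Suc mult.assoc)
  finally show ?case .
qed simp

lemma gbinomial_half_nonzero: "((1/2 :: 'a :: field_char_0) gchoose k) \<noteq> 0"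
proof -
  have "(1/2 :: 'a) \<noteq> of_nat i" for i
  proof
    assume "(1/2 :: 'a) = of_nat i"
    hence "of_nat 1 = (of_nat (2 * i) :: 'a)" by (simp add: field_simps)
    hence "1 = 2 * i" by (simp only: of_nat_eq_iff)
    thus False by presburger
  qed
  thus ?thesis by (auto simp: gbinomial_prod_rev)
qed

text \<open>
  The polynomials below are the numerators of \<open>(1/2 gchoose (k + j)) / (1/2 gchoose k)\<close>,
  for \<open>j \<le> e\<close> and as functions of \<open>k\<close>, over the common denominator
  \<open>(k + 1) \<cdots> (k + e)\<close>.
\<close>

definition ratio_poly :: "nat \<Rightarrow> nat \<Rightarrow> complex poly" where
  "ratio_poly e j = (\<Prod>l<j. [:1/2 - of_nat l, -1:]) * (\<Prod>l\<in>{j..<e}. [:of_nat l + 1, 1:])"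

lemma poly_ratio_poly:
  "poly (ratio_poly e j) x =
     (\<Prod>l<j. 1/2 - x - of_nat l) * (\<Prod>l\<in>{j..<e}. x + of_nat l + 1)"
  by (simp add: ratio_poly_def poly_prod algebra_simps)

lemma degree_ratio_poly:
  assumes "j \<le> e"
  shows "degree (ratio_poly e j) \<le> e"
proof -
  have "degree (ratio_poly e j) \<le> j + (e - j)"
    unfolding ratio_poly_def
    by (intro order.trans[OF degree_mult_le] add_mono order.trans[OF degree_prod_sum_le])
       auto
  thus ?thesis using assms by simp
qed

lemma gbinomial_half_ratio:
  assumes "j \<le> e"
  shows "(1/2 gchoose k) * poly (ratio_poly e j) (of_nat k) =
         (1/2 gchoose (k + j)) * (\<Prod>l<e. of_nat k + of_nat l + 1)"
proof -
  have split: "{..<e} = {..<j} \<union> {j..<e}" using assms by auto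
  have "(\<Prod>l<e. of_nat k + of_nat l + 1 :: complex) =
         (\<Prod>l<j. of_nat k + of_nat l + 1) * (\<Prod>l\<in>{j..<e}. of_nat k + of_nat l + 1)"
    unfolding split by (rule prod.union_disjoint) auto
  hence "(1/2 gchoose (k + j)) * (\<Prod>l<e. of_nat k + of_nat l + 1 :: complex) =
         (1/2 gchoose k) * (\<Prod>l<j. 1/2 - of_nat k - of_nat l) *
         (\<Prod>l\<in>{j..<e}. of_nat k + of_nat l + 1)"
    by (simp only: gbinomial_add_right[symmetric] mult.assoc)
  thus ?thesis by (simp only: poly_ratio_poly mult.assoc)
qed

lemma poly_ratio_poly_half_minus_eq_0:
  assumes "i < j"
  shows "poly (ratio_poly e j) (1/2 - of_nat i) = 0"
  using assms by (auto simp: poly_ratio_poly)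

lemma poly_ratio_poly_half_minus_nonzero:
  "poly (ratio_poly e i) (1/2 - of_nat i) \<noteq> 0"
proof -
  have "1/2 - of_nat i + of_nat l + 1 \<noteq> (0 :: complex)" for l :: nat
  proof
    assume "1/2 - of_nat i + of_nat l + 1 = (0 :: complex)"
    hence "of_nat (2 * l + 3) = (of_nat (2 * i) :: complex)"
      by (simp add: field_simps)
    hence "2 * l + 3 = 2 * i" by (simp only: of_nat_eq_iff)
    thus False by presburger
  qed
  thus ?thesis by (auto simp: poly_ratio_poly)
qed

text \<open>
  Evaluation at \<open>1/2, -1/2, -3/2, \<dots>\<close> is triangular on the numerators, with nonzero diagonal.
\<close>

lemma ratio_poly_independent:
  assumes "(\<Sum>j<d. Polynomial.smult (v j) (ratio_poly e j)) = 0" and "i < d"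
  shows "v i = 0"
  using \<open>i < d\<close>
proof (induction i rule: less_induct)
  case (less i)
  have "0 = poly (\<Sum>j<d. Polynomial.smult (v j) (ratio_poly e j)) (1/2 - of_nat i)"
    by (simp add: assms(1))
  also have "\<dots> = (\<Sum>j<d. v j * poly (ratio_poly e j) (1/2 - of_nat i))"
    by (simp add: poly_sum)
  also have "\<dots> = (\<Sum>j\<in>{i}. v j * poly (ratio_poly e j) (1/2 - of_nat i))"
  proof (rule sum.mono_neutral_right)
    show "\<forall>j\<in>{..<d} - {i}. v j * poly (ratio_poly e j) (1/2 - of_nat i) = 0"
    proof
      fix j assume "j \<in> {..<d} - {i}"
      hence "j < i \<or> i < j" "j < d" by auto
      thus "v j * poly (ratio_poly e j) (1/2 - of_nat i) = 0"
        using less.IH poly_ratio_poly_half_minus_eq_0 by auto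
    qed
  qed (use less.prems in auto)
  finally show ?case using poly_ratio_poly_half_minus_nonzero[of e i] by simp
qed

lemma det_hankel_gbinomial_half_nonzero:
  "Determinant.det (mat d d (\<lambda>(i, j). (1/2 :: complex) gchoose (i + j + r))) \<noteq> 0"
proof
  let ?A = "mat d d (\<lambda>(i, j). (1/2 :: complex) gchoose (i + j + r))"
  assume "Determinant.det ?A = 0"
  then obtain v where v: "v \<in> carrier_vec d" "v \<noteq> 0\<^sub>v d" "?A *\<^sub>v v = 0\<^sub>v d"
    using det_0_iff_vec_prod_zero[of ?A d] by auto
  hence "d > 0" by (cases d) auto
  define c where "c = vec_index v"
  have kernel: "(\<Sum>j<d. (1/2 gchoose (i + r + j)) * c j) = 0" if "i < d" for i
  proof -
    have "vec_index (?A *\<^sub>v v) i = 0" using v(3) that by simp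
    thus ?thesis using that v(1)
      by (simp add: scalar_prod_def c_def atLeast0LessThan ac_simps)
  qed
  define Q where "Q = (\<Sum>j<d. Polynomial.smult (c j) (ratio_poly (d - 1) j))"
  have root: "poly Q (of_nat (i + r)) = 0" if "i < d" for i
  proof -
    let ?D = "\<Prod>l<d - 1. of_nat (i + r) + of_nat l + 1 :: complex"
    have "(1/2 gchoose (i + r)) * poly Q (of_nat (i + r)) =
          (\<Sum>j<d. c j * ((1/2 gchoose (i + r)) * poly (ratio_poly (d - 1) j) (of_nat (i + r))))"
      unfolding Q_def by (simp add: poly_sum sum_distrib_left mult_ac)
    also have "\<dots> = (\<Sum>j<d. c j * ((1/2 gchoose (i + r + j)) * ?D))"
      by (intro sum.cong refl arg_cong2[of _ _ _ _ "(*)"] gbinomial_half_ratio) auto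
    also have "\<dots> = ?D * (\<Sum>j<d. (1/2 gchoose (i + r + j)) * c j)"
      by (simp add: sum_distrib_left mult_ac)
    finally show ?thesis using kernel[OF that] by (simp add: gbinomial_half_nonzero)
  qed
  have "Q = 0"
  proof (rule ccontr)
    assume "Q \<noteq> 0"
    let ?S = "(\<lambda>i. of_nat (i + r) :: complex) ` {..<d}"
    have "card ?S = d" by (subst card_image) (auto simp: inj_on_def)
    moreover have "card ?S \<le> card {x. poly Q x = 0}"
      using root by (intro card_mono poly_roots_finite \<open>Q \<noteq> 0\<close>) auto
    moreover have "card {x. poly Q x = 0} \<le> degree Q"
      using \<open>Q \<noteq> 0\<close> by (rule card_poly_roots_bound)
    moreover have "degree Q \<le> d - 1"
      unfolding Q_def
      by (intro degree_sum_le order.trans[OF degree_smult_le] degree_ratio_poly) auto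
    ultimately show False using \<open>d > 0\<close> by linarith
  qed
  hence "c i = 0" if "i < d" for i
    using ratio_poly_independent[of c "d - 1" d i] that by (simp add: Q_def)
  hence "v = 0\<^sub>v d" using v(1) by (intro eq_vecI) (auto simp: c_def)
  with v(2) show False by contradiction
qed

section \<open>Dependence on the ratio of the parameters\<close>

text \<open>
  Since \<open>x / 0 = 0\<close>, the parameter value \<open>0\<close> makes its factor of the radicand equal to \<open>1\<close>.
  So the radicand with parameters \<open>0\<close> and \<open>1\<close> is \<open>((1 - z) t + 1) (t + 1)\<close>: this is the
  one-parameter family to which the values at \<open>a\<close> and \<open>b\<close> belong.
\<close>

lemma B_coeff_at_first:
  assumes "a \<noteq> 0" "b \<noteq> 0"
  shows "B_coeff a b k (of_real a) = B_coeff 0 1 k (of_real (a / b))"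
  using assms by (simp add: B_coeff_def diff_divide_distrib)

lemma B_coeff_commute: "B_coeff a b k z = B_coeff b a k z"
  unfolding B_coeff_def by (simp only: mult_ac)

lemma B_poly_commute: "B_poly n a b z = B_poly n b a z"
  unfolding B_poly_def B_coeff_commute[of a b] ..

lemma B_poly_at_first:
  assumes "a \<noteq> 0" "b \<noteq> 0"
  shows "B_poly n a b (of_real a) = B_poly n 0 1 (of_real (a / b))"
  unfolding B_poly_def B_coeff_at_first[OF assms] ..

lemma B_poly_at_second:
  assumes "a \<noteq> 0" "b \<noteq> 0"
  shows "B_poly n a b (of_real b) = B_poly n 0 1 (of_real (b / a))"
  unfolding B_poly_commute[of n a b] using assms(2,1) by (rule B_poly_at_first)

lemma B_coeff_at_ratio_one: "B_coeff 0 1 k 1 = (1/2 gchoose k)"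
proof -
  define F where "F = Abs_fps (\<lambda>k. B_coeff 0 1 k 1)"
  define G where "G = fps_binomial (1/2 :: complex)"
  have "F * F = 1 + fps_X"
    using B_coeff_sqrt(1)[of 0 1 1] by (simp add: F_def fps_of_poly_pCons)
  moreover have "G * G = 1 + fps_X"
    using fps_binomial_add_mult[of "1/2 :: complex" "1/2"]
    by (simp add: G_def fps_binomial_1)
  ultimately have "(F - G) * (F + G) = 0" by (simp add: algebra_simps)
  \<comment> \<open>Both square roots have constant term \<open>1\<close>, so they cannot be opposite.\<close>
  moreover have "fps_nth (F + G) 0 \<noteq> 0"
    by (simp add: F_def G_def B_coeff_sqrt(2))
  hence "F + G \<noteq> 0" by (metis fps_zero_nth)
  ultimately have "F = G" by simp
  thus ?thesis by (metis F_def G_def fps_binomial_nth fps_nth_Abs_fps)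
qed

lemma B_poly_at_ratio_one_nonzero: "B_poly n 0 1 1 \<noteq> 0"
  using det_hankel_gbinomial_half_nonzero[of "n div 2" 2]
    det_hankel_gbinomial_half_nonzero[of "n div 2 - 1" 3]
  by (simp add: B_poly_def B_coeff_at_ratio_one Let_def eval_nat_numeral)

theorem proposition2p23:
  fixes n :: nat
  assumes "n \<ge> 3"
  shows "\<exists>R :: real set. finite R \<and>
           (\<forall>a b :: real. a \<noteq> 0 \<longrightarrow> b \<noteq> 0 \<longrightarrow> a / b \<notin> R \<longrightarrow>
              B_poly n a b (of_real a) \<noteq> 0 \<and> B_poly n a b (of_real b) \<noteq> 0)"
proof -
  obtain p where p: "\<And>z. B_poly n 0 1 z = poly p z"
    using B_poly_polynomial by blast
  have "p \<noteq> 0" using p[of 1] B_poly_at_ratio_one_nonzero[of n] by auto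
  define Z :: "real set" where "Z = {x. poly p (of_real x) = 0}"
  have "Z = of_real -` {z. poly p z = 0}" by (auto simp: Z_def)
  hence "finite Z"
    using finite_vimageI[OF poly_roots_finite[OF \<open>p \<noteq> 0\<close>] inj_of_real] by simp
  show ?thesis
  proof (intro exI[of _ "Z \<union> inverse ` Z"] conjI allI impI)
    show "finite (Z \<union> inverse ` Z)" using \<open>finite Z\<close> by simp
    fix a b :: real assume ab: "a \<noteq> 0" "b \<noteq> 0" "a / b \<notin> Z \<union> inverse ` Z"
    have "a / b \<notin> Z" using ab(3) by blast
    thus "B_poly n a b (of_real a) \<noteq> 0"
      unfolding B_poly_at_first[OF ab(1,2)] p Z_def by blast
    have "a / b = inverse (b / a)" by simp
    hence "b / a \<notin> Z" using ab(3) by blast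
    thus "B_poly n a b (of_real b) \<noteq> 0"
      unfolding B_poly_at_second[OF ab(1,2)] p Z_def by blast
  qed
qed

end
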